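(* Let $\mathcal{B}$ be a building set on $[n]$ and let $$\mathcal{P}=\sum_{i\in[n]}\mathrm{Conv}(0,e_i)+\sum_{I\in\mathcal{B}}\mathrm{Conv}(\{e_S: S\subsetneq I\})\subseteq\mathbb{R}^n$$ (Minkowski sum), where $e_1,\dots,e_n$ is the standard basis and $e_S=\sum_{i\in S}e_i$ (so $e_\varnothing=0$). Then $\mathcal{P}$ is combinatorially equivalent to (has face lattice isomorphic to that of) the extended nestohedron $\mathcal{P}^{\square}(\mathcal{B})$.
   Context: A building set on $[n]$ is a collection $\mathcal{B}$ of nonempty subsets of $[n]$ containing all singletons and such that $I\cup J\in\mathcal{B}$ whenever $I,J\in\mathcal{B}$, $I\cap J\neq\varnothing$. An extended nested collection is a set $\{I_1,\dots,I_m,x_{i_1},\dots,x_{i_r}\}$ with $I_j\in\mathcal{B}$ (maximal elements allowed) and formal symbols $x_i$ ($i\in[n]$) such that the $I_j$ are pairwise nested or disjoint, no union of $k\ge2$ pairwise disjoint $I_j$'s lies in $\mathcal{B}$, and no $i_\ell$ lies in any $I_j$. The extended nested complex $\mathcal{N}^{\square}(\mathcal{B})$ (vertex set $\mathcal{B}\cup\{x_1,\dots,x_n\}$, faces the extended nested collections) is the boundary complex of an $n$-dimensional simplicial polytope; the extended nestohedron $\mathcal{P}^{\square}(\mathcal{B})$ is the polar dual simple polytope, i.e. an $n$-dimensional simple polytope whose facets correspond to the vertices of $\mathcal{N}^{\square}(\mathcal{B})$ in such a way that a set of facets has nonempty common intersection iff the corresponding vertices form an extended nested collection. *)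

theory Defs
  imports "HOL-Analysis.Analysis"
begin

text \<open>The ground set \<open>[n]\<close> is the finite index type \<open>'n\<close>, so that \<open>n = CARD('n)\<close> and
  \<open>\<real>\<^sup>n\<close> is \<open>real ^ 'n\<close>.\<close>

definition building_set :: "'n::finite set set \<Rightarrow> bool" where
  "building_set B \<longleftrightarrow>
     {} \<notin> B \<and> (\<forall>i. {i} \<in> B) \<and>
     (\<forall>I\<in>B. \<forall>J\<in>B. I \<inter> J \<noteq> {} \<longrightarrow> I \<union> J \<in> B)"

text \<open>In the vertex set \<open>B <+> UNIV\<close> of the extended nested complex, \<open>Inl I\<close> is the block \<open>I \<in> B\<close>
  and \<open>Inr i\<close> is the formal symbol \<open>x\<^sub>i\<close>.\<close>

definition extended_nested_collection :: "'n::finite set set \<Rightarrow> ('n set + 'n) set \<Rightarrow> bool" where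
  "extended_nested_collection B N \<longleftrightarrow>
     N \<subseteq> B <+> UNIV \<and>
     (\<forall>I J. Inl I \<in> N \<longrightarrow> Inl J \<in> N \<longrightarrow> I \<subseteq> J \<or> J \<subseteq> I \<or> I \<inter> J = {}) \<and>
     (\<forall>M. M \<subseteq> {I. Inl I \<in> N} \<longrightarrow> 2 \<le> card M \<longrightarrow> pairwise disjnt M \<longrightarrow> \<Union>M \<notin> B) \<and>
     (\<forall>i I. Inr i \<in> N \<longrightarrow> Inl I \<in> N \<longrightarrow> i \<notin> I)"

definition extended_nested_complex :: "'n::finite set set \<Rightarrow> ('n set + 'n) set set" where
  "extended_nested_complex B = {N. extended_nested_collection B N}"

definition simple_polytope :: "'a::euclidean_space set \<Rightarrow> bool" where
  "simple_polytope Q \<longleftrightarrow>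
     polytope Q \<and>
     (\<forall>v. v extreme_point_of Q \<longrightarrow> int (card {F. F facet_of Q \<and> v \<in> F}) = aff_dim Q)"

text \<open>The extended nestohedron is determined by \<open>B\<close> only up to combinatorial equivalence, hence it
  is a predicate on polytopes. In the last clause, the empty set of facets has intersection
  \<open>\<Inter>{} = UNIV\<close>; accordingly the empty collection is an extended nested collection.\<close>

definition is_extended_nestohedron :: "'n::finite set set \<Rightarrow> 'a::euclidean_space set \<Rightarrow> bool" where
  "is_extended_nestohedron B Q \<longleftrightarrow>
     simple_polytope Q \<and> aff_dim Q = int CARD('n) \<and>
     (\<exists>\<phi>. bij_betw \<phi> (B <+> UNIV) {F. F facet_of Q} \<and>
          (\<forall>N. N \<subseteq> B <+> UNIV \<longrightarrow>
                (\<Inter>(\<phi> ` N) \<noteq> {} \<longleftrightarrow> N \<in> extended_nested_complex B)))"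

text \<open>The face lattice \<open>{F. F face_of P}\<close> contains \<open>{}\<close> and, for convex \<open>P\<close>, also \<open>P\<close> itself.\<close>

definition combinatorially_equivalent ::
    "'a::euclidean_space set \<Rightarrow> 'b::euclidean_space set \<Rightarrow> bool" where
  "combinatorially_equivalent P Q \<longleftrightarrow>
     (\<exists>f. bij_betw f {F. F face_of P} {G. G face_of Q} \<and>
          (\<forall>F F'. F face_of P \<longrightarrow> F' face_of P \<longrightarrow> (F \<subseteq> F' \<longleftrightarrow> f F \<subseteq> f F')))"

definition indicator_vec :: "'n::finite set \<Rightarrow> real ^ 'n" where
  "indicator_vec S = (\<Sum>i\<in>S. axis i 1)"

text \<open>Addition and summation of sets are Minkowski addition and summation here
  (\<open>HOL-Library.Set_Algebras\<close>).\<close>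

definition minkowski_polytope :: "'n::finite set set \<Rightarrow> (real ^ 'n) set" where
  "minkowski_polytope B =
     (\<Sum>i\<in>UNIV. convex hull {0, axis i 1}) +
     (\<Sum>I\<in>B. convex hull {indicator_vec S | S. S \<subset> I})"

end

theory Submission
  imports Defs
begin

text \<open>The Minkowski sum is the polymatroid cut out by \<open>x \<ge> 0\<close> and \<open>x(I) \<le> f(I)\<close> for \<open>I \<in> B\<close>, where
  \<open>f\<close> is its support function on indicator vectors. Submodularity of \<open>f\<close>, strict when the union of
  two incomparable sets is a block, makes the set of tight inequalities at every point an extended
  nested collection. Conversely, for an extended nested collection \<open>N\<close> every block \<open>J\<close> has a pivot
  \<open>j \<in> J\<close> such that each block of \<open>N\<close> containing \<open>j\<close> contains \<open>J\<close>; dropping the pivots produces a point of the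
  Minkowski sum at which all of \<open>N\<close> is tight, and triangularity with respect to the pivots makes the
  normals of \<open>N\<close> linearly independent. Hence the polymatroid is simple with the required facet
  complex, and by Krein--Milman it equals the Minkowski sum. Finally, the facet complex of a simple
  polytope determines its face lattice, because near a vertex the facet normals are independent and
  so any set of facets through the vertex is the exact set of facets through some point.\<close>

subsection \<open>Nondegenerate systems of linear inequalities\<close>

text \<open>Strict inequalities survive short moves in both directions; one \<open>e\<close> serves
  all of them because \<open>V\<close> is finite.\<close>

lemma slack_small_step:
  fixes a :: "'v \<Rightarrow> 'a::real_inner"
  assumes "finite V"
  obtains e where "e > 0"
    and "\<And>v c. v \<in> V \<Longrightarrow> a v \<bullet> x < b v \<Longrightarrow> \<bar>c\<bar> \<le> e \<Longrightarrow> a v \<bullet> (x + c *\<^sub>R d) < b v"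
proof -
  have "\<forall>\<^sub>F e in at_right (0::real). a v \<bullet> x < b v \<longrightarrow> a v \<bullet> x + e * \<bar>a v \<bullet> d\<bar> < b v" for v
  proof (cases "a v \<bullet> x < b v")
    case True
    have "((\<lambda>e. a v \<bullet> x + e * \<bar>a v \<bullet> d\<bar>) \<longlongrightarrow> a v \<bullet> x + 0 * \<bar>a v \<bullet> d\<bar>) (at_right 0)"
      by (intro tendsto_intros)
    then have "\<forall>\<^sub>F e in at_right 0. a v \<bullet> x + e * \<bar>a v \<bullet> d\<bar> < b v"
      using True by (intro order_tendstoD(2)) simp_all
    then show ?thesis
      by (rule eventually_mono) simp
  qed simp
  then have "\<forall>\<^sub>F e in at_right (0::real). \<forall>v\<in>V. a v \<bullet> x < b v \<longrightarrow> a v \<bullet> x + e * \<bar>a v \<bullet> d\<bar> < b v"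
    using assms by (simp add: eventually_ball_finite)
  moreover have "\<forall>\<^sub>F e in at_right (0::real). 0 < e"
    by (simp add: eventually_at_right_less)
  ultimately have "\<forall>\<^sub>F e in at_right (0::real). 0 < e \<and> (\<forall>v\<in>V. a v \<bullet> x < b v \<longrightarrow> a v \<bullet> x + e * \<bar>a v \<bullet> d\<bar> < b v)"
    by eventually_elim blast
  then obtain e where e: "0 < e" "\<And>v. v \<in> V \<Longrightarrow> a v \<bullet> x < b v \<Longrightarrow> a v \<bullet> x + e * \<bar>a v \<bullet> d\<bar> < b v"
    using eventually_happens'[OF trivial_limit_at_right_real] by blast
  show ?thesis
  proof
    fix v c assume vc: "v \<in> V" "a v \<bullet> x < b v" "\<bar>c\<bar> \<le> e"
    have "c * (a v \<bullet> d) \<le> \<bar>c\<bar> * \<bar>a v \<bullet> d\<bar>"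
      by (metis abs_ge_self abs_mult)
    also have "\<dots> \<le> e * \<bar>a v \<bullet> d\<bar>"
      using vc(3) by (intro mult_right_mono) auto
    finally show "a v \<bullet> (x + c *\<^sub>R d) < b v"
      using e(2)[OF vc(1,2)] by (simp add: inner_add_right)
  qed (rule e(1))
qed

text \<open>A linear functional with values \<open>c u\<close> is represented by a vector, and
  projecting that vector to \<open>span A\<close> keeps these values. Membership in the span later
  keeps perturbed points inside \<open>L\<close>.\<close>

lemma exists_prescribed_inner:
  fixes A :: "'a::euclidean_space set"
  assumes "independent A"
  obtains w where "w \<in> span A" "\<And>u. u \<in> A \<Longrightarrow> u \<bullet> w = c u"
proof -
  obtain g :: "'a \<Rightarrow> real" where g: "linear g" "\<And>u. u \<in> A \<Longrightarrow> g u = c u"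
    using linear_independent_extend[OF assms, of c] by blast
  define w0 where "w0 = (\<Sum>i\<in>Basis. g i *\<^sub>R i)"
  have w0: "g u = u \<bullet> w0" for u
  proof -
    have "g u = g (\<Sum>i\<in>Basis. (u \<bullet> i) *\<^sub>R i)" by (simp add: euclidean_representation)
    also have "\<dots> = u \<bullet> w0"
      by (simp add: linear_sum[OF g(1)] linear_cmul[OF g(1)] w0_def inner_sum_right mult.commute)
    finally show ?thesis .
  qed
  obtain y z where yz: "y \<in> span A" "\<And>w. w \<in> span A \<Longrightarrow> orthogonal z w" "w0 = y + z"
    using orthogonal_subspace_decomp_exists[of A w0] by metis
  have "u \<bullet> y = c u" if "u \<in> A" for u
    using yz(2)[OF span_base[OF that]] w0[of u] g(2)[OF that] yz(3)
    by (simp add: orthogonal_def inner_add_right inner_commute)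
  then show ?thesis using that yz(1) by blast
qed

definition tight :: "'v set \<Rightarrow> ('v \<Rightarrow> 'a::real_inner) \<Rightarrow> ('v \<Rightarrow> real) \<Rightarrow> 'a \<Rightarrow> 'v set" where
  "tight V a b x = {v \<in> V. a v \<bullet> x = b v}"

text \<open>\<open>L\<close> allows for polytopes that are not full-dimensional in their ambient
  space; \<open>parallel\<close> puts every normal into the direction space of
  \<open>L\<close>.\<close>

locale inequality_system =
  fixes L :: "'a::euclidean_space set" and V :: "'v set" and a :: "'v \<Rightarrow> 'a" and b :: "'v \<Rightarrow> real"
  assumes finV: "finite V" and affL: "affine L"
    and parallel: "\<And>v x. v \<in> V \<Longrightarrow> x \<in> L \<Longrightarrow> x + a v \<in> L"
begin

definition sols :: "'a set" where
  "sols = {x \<in> L. \<forall>v\<in>V. a v \<bullet> x \<le> b v}"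

abbreviation tgt :: "'a \<Rightarrow> 'v set" where
  "tgt \<equiv> tight V a b"

lemma directions_subspace: "x \<in> L \<Longrightarrow> subspace ((\<lambda>y. y - x) ` L)"
  using affL by (rule affine_diffs_subspace_subtract)

lemma normal_in_directions: "x \<in> L \<Longrightarrow> v \<in> V \<Longrightarrow> a v \<in> (\<lambda>y. y - x) ` L"
  using parallel[of v x] by (force simp: image_iff)

lemma span_normals_subset: "x \<in> L \<Longrightarrow> W \<subseteq> V \<Longrightarrow> span (a ` W) \<subseteq> (\<lambda>y. y - x) ` L"
  by (rule span_minimal) (use normal_in_directions directions_subspace in auto)

lemma direction_scale:
  assumes "x \<in> L" "d \<in> (\<lambda>y. y - x) ` L"
  shows "x + e *\<^sub>R d \<in> L"
  using subspace_scale[OF directions_subspace assms(2), of e] assms(1)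
  by (auto simp: image_iff algebra_simps)

text \<open>By independence some direction \<open>d\<close> has inner product 0 with the normals of
  \<open>M\<close> and -1 with the other tight ones. A short step along \<open>d\<close> leaves
  exactly \<open>M\<close> tight.\<close>

lemma exact_tight_set:
  assumes x: "x \<in> sols" and inj: "inj_on a (tgt x)" and ind: "independent (a ` tgt x)"
    and M: "M \<subseteq> tgt x"
  obtains y where "y \<in> sols" "tgt y = M"
proof -
  have xL: "x \<in> L" using x by (simp add: sols_def)
  obtain d where d: "d \<in> span (a ` tgt x)"
      "\<And>u. u \<in> a ` tgt x \<Longrightarrow> u \<bullet> d = (if u \<in> a ` M then 0 else -1)"
    using exists_prescribed_inner[OF ind, of "\<lambda>u. if u \<in> a ` M then 0 else -1"] by blast
  have dM: "a v \<bullet> d = (if v \<in> M then 0 else -1)" if "v \<in> tgt x" for v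
    using d(2)[of "a v"] that inj M by (auto simp: inj_on_def)
  obtain e where e: "e > 0"
      "\<And>v c. v \<in> V \<Longrightarrow> a v \<bullet> x < b v \<Longrightarrow> \<bar>c\<bar> \<le> e \<Longrightarrow> a v \<bullet> (x + c *\<^sub>R d) < b v"
    using slack_small_step[OF finV, of a x b] by blast
  define y where "y = x + e *\<^sub>R d"
  have "tgt x \<subseteq> V" by (auto simp: tight_def)
  then have yL: "y \<in> L"
    using direction_scale[OF xL] span_normals_subset[OF xL] d(1) unfolding y_def by blast
  have cases: "if v \<in> M then a v \<bullet> y = b v else a v \<bullet> y < b v" if v: "v \<in> V" for v
  proof (cases "v \<in> tgt x")
    case True
    then show ?thesis
      using dM[OF True] e(1) by (auto simp: y_def tight_def inner_add_right)
  next
    case False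
    then have "a v \<bullet> x < b v"
      using x v by (auto simp: sols_def tight_def less_le)
    from e(2)[OF v this, of e] e(1) have "a v \<bullet> y < b v"
      by (simp add: y_def)
    then show ?thesis using False M by auto
  qed
  show ?thesis
  proof
    have "a v \<bullet> y \<le> b v" if "v \<in> V" for v
      using cases[OF that] by (cases "v \<in> M") auto
    then show "y \<in> sols"
      using yL by (simp add: sols_def)
    have "a v \<bullet> y = b v \<longleftrightarrow> v \<in> M" if "v \<in> V" for v
      using cases[OF that] by (cases "v \<in> M") auto
    then show "tgt y = M"
      using M by (auto simp: tight_def)
  qed
qed

text \<open>If the tight normals spanned less, a direction of \<open>L\<close> orthogonal to all of
  them could be followed both ways, making \<open>x\<close> the midpoint of a segment in
  \<open>sols\<close>.\<close>

lemma extreme_point_span: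
  assumes ext: "x extreme_point_of sols"
  shows "span (a ` tgt x) = (\<lambda>y. y - x) ` L"
proof (rule ccontr)
  assume ne: "span (a ` tgt x) \<noteq> (\<lambda>y. y - x) ` L"
  have x: "x \<in> sols" using ext by (simp add: extreme_point_of_def)
  then have xL: "x \<in> L" by (simp add: sols_def)
  have "span (a ` tgt x) \<subseteq> (\<lambda>y. y - x) ` L"
    by (rule span_normals_subset[OF xL]) (auto simp: tight_def)
  moreover have sW: "span ((\<lambda>y. y - x) ` L) = (\<lambda>y. y - x) ` L"
    using directions_subspace[OF xL] span_eq_iff by blast
  ultimately have "span (a ` tgt x) \<subset> span ((\<lambda>y. y - x) ` L)"
    unfolding sW using ne by blast
  then obtain d where d: "d \<noteq> 0" "d \<in> span ((\<lambda>y. y - x) ` L)"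
      "\<And>y. y \<in> span (a ` tgt x) \<Longrightarrow> orthogonal d y"
    using orthogonal_to_subspace_exists_gen by blast
  then have dL: "d \<in> (\<lambda>y. y - x) ` L" using sW by simp
  obtain e where e: "e > 0"
      "\<And>v c. v \<in> V \<Longrightarrow> a v \<bullet> x < b v \<Longrightarrow> \<bar>c\<bar> \<le> e \<Longrightarrow> a v \<bullet> (x + c *\<^sub>R d) < b v"
    using slack_small_step[OF finV, of a x b] by blast
  have "x + c *\<^sub>R d \<in> sols" if c: "\<bar>c\<bar> = e" for c
  proof -
    have "a v \<bullet> (x + c *\<^sub>R d) \<le> b v" if v: "v \<in> V" for v
    proof (cases "v \<in> tgt x")
      case True
      then have "a v \<bullet> d = 0"
        using d(3)[OF span_base, of "a v"] by (auto simp: orthogonal_def inner_commute)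
      then show ?thesis using True by (simp add: tight_def inner_add_right)
    next
      case False
      then have "a v \<bullet> x < b v"
        using x v by (auto simp: sols_def tight_def less_le)
      from e(2)[OF v this, of c] c show ?thesis
        by simp
    qed
    then show ?thesis
      using direction_scale[OF xL dL] by (auto simp: sols_def)
  qed
  from this[of e] this[of "-e"] have "x + e *\<^sub>R d \<in> sols" "x - e *\<^sub>R d \<in> sols"
    using e(1) by auto
  moreover have "x \<in> open_segment (x + e *\<^sub>R d) (x - e *\<^sub>R d)"
  proof -
    have "x = midpoint (x + e *\<^sub>R d) (x - e *\<^sub>R d)"
      by (simp add: midpoint_def flip: scaleR_add_left)
    moreover have "x + e *\<^sub>R d \<noteq> x - e *\<^sub>R d"
      using d(1) e(1) by (simp add: eq_diff_eq flip: scaleR_left_distrib)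
    ultimately show ?thesis
      by (metis midpoint_in_open_segment)
  qed
  ultimately show False
    using ext by (auto simp: extreme_point_of_def)
qed

section \<open>Facets of the solution set\<close>

lemma polyhedron_sols: "polyhedron sols"
proof -
  have "sols = L \<inter> \<Inter>((\<lambda>v. {x. a v \<bullet> x \<le> b v}) ` V)"
    by (auto simp: sols_def)
  moreover have "polyhedron (\<Inter>((\<lambda>v. {x. a v \<bullet> x \<le> b v}) ` V))"
    using finV by (intro polyhedron_Inter) (auto simp: polyhedron_halfspace_le)
  ultimately show ?thesis
    by (simp add: affine_imp_polyhedron[OF affL] polyhedron_Int)
qed

text \<open>The hypothesis \<open>single\<close> makes every inequality irredundant, so the explicit
  description of facets by a minimal family of half-spaces applies.\<close>

lemma facets_sols:
  assumes hull: "affine hull sols = L"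
    and single: "\<And>v. v \<in> V \<Longrightarrow> a v \<noteq> 0 \<and> (\<exists>x\<in>sols. tgt x = {v})"
  shows "bij_betw (\<lambda>v. {x \<in> sols. a v \<bullet> x = b v}) V {F. F facet_of sols}"
proof -
  define H where "H v = {x. a v \<bullet> x \<le> b v}" for v
  \<comment> \<open>From a point where \<open>v\<close> alone is tight, a short step along
    \<open>a v\<close> violates \<open>v\<close> and no other inequality.\<close>
  have beyond: "\<exists>y\<in>L. y \<notin> H v \<and> (\<forall>u\<in>V - {v}. y \<in> H u)" if v: "v \<in> V" for v
  proof -
    obtain x where x: "x \<in> sols" "tgt x = {v}" using single[OF v] by auto
    obtain e where e: "e > 0"
      "\<And>u c. u \<in> V \<Longrightarrow> a u \<bullet> x < b u \<Longrightarrow> \<bar>c\<bar> \<le> e \<Longrightarrow> a u \<bullet> (x + c *\<^sub>R a v) < b u"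
      using slack_small_step[OF finV, of a x b] by blast
    have xL: "x \<in> L" using x(1) by (simp add: sols_def)
    have "x + e *\<^sub>R a v \<in> L"
      by (rule direction_scale[OF xL normal_in_directions[OF xL v]])
    moreover have "x + e *\<^sub>R a v \<notin> H v"
    proof -
      have "a v \<bullet> x = b v" using x(2) by (auto simp: tight_def)
      moreover have "0 < e * (a v \<bullet> a v)" using e(1) single[OF v] by simp
      ultimately show ?thesis by (simp add: H_def inner_add_right)
    qed
    moreover have "x + e *\<^sub>R a v \<in> H u" if u: "u \<in> V - {v}" for u
    proof -
      have "u \<notin> tgt x" using x(2) u by simp
      then have "a u \<bullet> x < b u"
        using x(1) u by (auto simp: sols_def tight_def less_le)
      from e(2)[OF _ this, of e] u e(1) show ?thesis
        by (simp add: H_def)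
    qed
    ultimately show ?thesis by blast
  qed
  have injH: "inj_on H V"
  proof (rule inj_onI, rule ccontr)
    fix u v assume "u \<in> V" "v \<in> V" "H u = H v" "u \<noteq> v"
    obtain y where "y \<notin> H v" "\<forall>w\<in>V - {v}. y \<in> H w" using beyond[OF \<open>v \<in> V\<close>] by blast
    with \<open>u \<in> V\<close> \<open>u \<noteq> v\<close> \<open>H u = H v\<close> show False by auto
  qed
  have sols_eq: "sols = affine hull sols \<inter> \<Inter>(H ` V)"
    unfolding hull by (auto simp: sols_def H_def)
  \<comment> \<open>\<open>facet_of_polyhedron_explicit\<close> indexes normals by the half-spaces
    themselves; \<open>r\<close> recovers the index from the half-space.\<close>
  define r where "r = inv_into V H"
  have r: "r (H v) = v" if "v \<in> V" for v
    using that injH by (simp add: r_def)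
  have "C facet_of sols \<longleftrightarrow> (\<exists>h. h \<in> H ` V \<and> C = sols \<inter> {x. a (r h) \<bullet> x = b (r h)})" for C
  proof (rule facet_of_polyhedron_explicit[OF _ sols_eq])
    show "finite (H ` V)" using finV by simp
    show "a (r h) \<noteq> 0 \<and> h = {x. a (r h) \<bullet> x \<le> b (r h)}" if "h \<in> H ` V" for h
      using that r single by (auto simp: H_def)
    show "sols \<subset> affine hull sols \<inter> \<Inter>F'" if F': "F' \<subset> H ` V" for F'
    proof -
      obtain v where v: "v \<in> V" "H v \<notin> F'" using F' by auto
      obtain y where y: "y \<in> L" "y \<notin> H v" "\<And>u. u \<in> V - {v} \<Longrightarrow> y \<in> H u"
        using beyond[OF v(1)] by blast
      have "y \<in> \<Inter>F'"
      proof
        fix h assume "h \<in> F'"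
        with F' obtain u where "u \<in> V" "h = H u" by auto
        with \<open>h \<in> F'\<close> v y(3) show "y \<in> h" by blast
      qed
      moreover have "y \<notin> sols" using y(2) v(1) by (auto simp: sols_def H_def)
      ultimately show ?thesis using sols_eq F' y(1) hull by blast
    qed
  qed
  then have "C facet_of sols \<longleftrightarrow> (\<exists>v\<in>V. C = {x \<in> sols. a v \<bullet> x = b v})" for C
    by (auto simp: r Int_def)
  then have "{F. F facet_of sols} = (\<lambda>v. {x \<in> sols. a v \<bullet> x = b v}) ` V"
    by auto
  moreover have "inj_on (\<lambda>v. {x \<in> sols. a v \<bullet> x = b v}) V"
  proof (rule inj_onI)
    fix u v assume uv: "u \<in> V" "v \<in> V" and eq: "{x \<in> sols. a u \<bullet> x = b u} = {x \<in> sols. a v \<bullet> x = b v}"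
    obtain x where "x \<in> sols" "tgt x = {u}" using single[OF uv(1)] by auto
    then have "x \<in> {x \<in> sols. a v \<bullet> x = b v}"
      using eq by (auto simp: tight_def)
    then have "v \<in> tgt x" using uv by (simp add: tight_def)
    then show "u = v" using \<open>tgt x = {u}\<close> by simp
  qed
  ultimately show ?thesis by (simp add: bij_betw_def)
qed

lemma facets_through_point:
  assumes bij: "bij_betw (\<lambda>v. {x \<in> sols. a v \<bullet> x = b v}) V {F. F facet_of sols}" and y: "y \<in> sols"
  shows "bij_betw (\<lambda>v. {x \<in> sols. a v \<bullet> x = b v}) (tgt y) {F. F facet_of sols \<and> y \<in> F}"
proof (rule bij_betw_subset[OF bij])
  show "tgt y \<subseteq> V" by (auto simp: tight_def)
  have "{F. F facet_of sols} = (\<lambda>v. {x \<in> sols. a v \<bullet> x = b v}) ` V"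
    using bij by (simp add: bij_betw_def)
  then have "{F. F facet_of sols \<and> y \<in> F} = {F \<in> (\<lambda>v. {x \<in> sols. a v \<bullet> x = b v}) ` V. y \<in> F}"
    by blast
  also have "\<dots> = (\<lambda>v. {x \<in> sols. a v \<bullet> x = b v}) ` tgt y"
    using y by (auto simp: tight_def)
  finally show "(\<lambda>v. {x \<in> sols. a v \<bullet> x = b v}) ` tgt y = {F. F facet_of sols \<and> y \<in> F}" ..
qed

text \<open>Nondegeneracy is required at every point, not only at the vertices; redundant inequalities are
  excluded by requiring each one to be attained.\<close>

context
  assumes full: "L = UNIV" and bdd: "bounded sols" and nonempty: "sols \<noteq> {}"
    and nondegenerate: "\<And>x. x \<in> sols \<Longrightarrow> inj_on a (tgt x) \<and> independent (a ` tgt x)"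
    and attained: "\<And>v. v \<in> V \<Longrightarrow> \<exists>x\<in>sols. v \<in> tgt x"
begin

text \<open>The empty set is an exact tight set, and a point with no tight inequality is
  interior.\<close>

lemma full_dimensional: "aff_dim sols = int DIM('a)"
proof -
  obtain x where x: "x \<in> sols" using nonempty by blast
  obtain y where y: "y \<in> sols" "tgt y = {}"
    using exact_tight_set[OF x, of "{}"] nondegenerate[OF x] by blast
  let ?U = "\<Inter>((\<lambda>v. {x. a v \<bullet> x < b v}) ` V)"
  have "open ?U" using finV by (intro open_INT) (auto simp: open_halfspace_lt)
  moreover have "?U \<subseteq> sols" unfolding sols_def using full by (auto intro: less_imp_le)
  moreover have "y \<in> ?U" using y by (auto simp: sols_def tight_def less_le)
  ultimately have "interior sols \<noteq> {}" using interior_maximal by blast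
  then show ?thesis by (rule aff_dim_nonempty_interior)
qed

text \<open>Wherever \<open>v\<close> is tight, \<open>exact_tight_set\<close> supplies a nearby
  point at which it is the only tight inequality.\<close>

lemma facets_nondegenerate: "bij_betw (\<lambda>v. {x \<in> sols. a v \<bullet> x = b v}) V {F. F facet_of sols}"
proof (rule facets_sols)
  show "affine hull sols = L" using full_dimensional aff_dim_eq_full[of sols] full by blast
next
  fix v assume "v \<in> V"
  then obtain x where x: "x \<in> sols" "v \<in> tgt x" using attained by blast
  obtain y where y: "y \<in> sols" "tgt y = {v}"
    using exact_tight_set[OF x(1), of "{v}"] nondegenerate[OF x(1)] x(2) by blast
  have "0 \<notin> a ` tgt x" using nondegenerate[OF x(1)] dependent_zero by blast
  then show "a v \<noteq> 0 \<and> (\<exists>x\<in>sols. tgt x = {v})"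
    using x y by force
qed

text \<open>At an extreme point the tight normals both span and are independent, so they form a
  basis, one vector for each facet through the point.\<close>

lemma simple_polytope_sols: "simple_polytope sols"
  unfolding simple_polytope_def
proof (intro conjI allI impI)
  show "polytope sols" using polyhedron_sols bdd by (simp add: polytope_eq_bounded_polyhedron)
next
  fix x assume ext: "x extreme_point_of sols"
  then have x: "x \<in> sols" by (simp add: extreme_point_of_def)
  have "card {F. F facet_of sols \<and> x \<in> F} = card (tgt x)"
    using bij_betw_same_card[OF facets_through_point[OF facets_nondegenerate x]] by simp
  also have "\<dots> = card (a ` tgt x)"
    using nondegenerate[OF x] by (simp add: card_image)
  also have "\<dots> = dim (span (a ` tgt x))"
    using nondegenerate[OF x] by (simp add: dim_eq_card_independent)
  also have "span (a ` tgt x) = UNIV"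
    using extreme_point_span[OF ext] surj_diff_right[of x] full by blast
  finally show "int (card {F. F facet_of sols \<and> x \<in> F}) = aff_dim sols"
    by (simp add: full_dimensional)
qed

end

end

subsection \<open>Face lattices of simple polytopes\<close>

text \<open>Minimality of a half-space description yields for each \<open>h\<close> a point
  violating only \<open>h\<close>; joining it to a relative interior point gives one where only
  \<open>h\<close> is tight.\<close>

lemma polyhedron_inequality_system:
  fixes Q :: "'a::euclidean_space set"
  assumes "polyhedron Q" "Q \<noteq> {}"
  obtains V :: "'a set set" and a b where
    "inequality_system (affine hull Q) V a"
    "inequality_system.sols (affine hull Q) V a b = Q"
    "\<And>v. v \<in> V \<Longrightarrow> a v \<noteq> 0 \<and> (\<exists>x\<in>Q. tight V a b x = {v})"
proof -
  let ?L = "affine hull Q"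
  obtain V where V: "finite V" "Q = ?L \<inter> \<Inter>V"
      "\<And>h. h \<in> V \<Longrightarrow> \<exists>a b. a \<noteq> 0 \<and> h = {x. a \<bullet> x \<le> b} \<and> (\<forall>x\<in>?L. x + a \<in> ?L)"
      "\<And>F'. F' \<subset> V \<Longrightarrow> Q \<subset> ?L \<inter> \<Inter>F'"
    using assms(1) polyhedron_Int_affine_parallel_minimal[of Q] by meson
  obtain a b where ab: "\<And>h. h \<in> V \<Longrightarrow> a h \<noteq> 0 \<and> h = {x. a h \<bullet> x \<le> b h}"
      and par: "\<And>h x. h \<in> V \<Longrightarrow> x \<in> ?L \<Longrightarrow> x + a h \<in> ?L"
    using V(3) by metis
  interpret inequality_system ?L V a b
    using V(1) par by unfold_locales (auto simp: affine_affine_hull)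
  have sols: "sols = Q"
    using V(2) ab unfolding sols_def by blast
  have "\<exists>x\<in>Q. tgt x = {h}" if h: "h \<in> V" for h
  proof -
    have "V - {h} \<subset> V" using h by blast
    from V(4)[OF this] obtain y where y: "y \<in> ?L" "y \<in> \<Inter>(V - {h})" "y \<notin> Q" by blast
    have yh: "a h \<bullet> y > b h"
      using y V(2) ab[OF h] by (metis Diff_iff Int_iff Inter_iff insert_iff linorder_not_le mem_Collect_eq empty_iff)
    \<comment> \<open>The segment from a relative interior point \<open>z\<close> to \<open>y\<close> leaves \<open>Q\<close> through the facet of \<open>h\<close> only.\<close>
    obtain z where "z \<in> rel_interior Q"
      using assms polyhedron_imp_convex rel_interior_eq_empty by blast
    then have z: "z \<in> Q" "\<And>u. u \<in> V \<Longrightarrow> a u \<bullet> z < b u"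
      using rel_interior_polyhedron_explicit[OF V(1,2) ab V(4)] by auto
    define t where "t = (b h - a h \<bullet> z) / (a h \<bullet> y - a h \<bullet> z)"
    have t: "0 < t" "t < 1" using z(2)[OF h] yh by (auto simp: t_def field_simps)
    define x where "x = (1 - t) *\<^sub>R z + t *\<^sub>R y"
    have xL: "x \<in> ?L"
      unfolding x_def using z(1) y(1) by (intro mem_affine[OF affL]) (auto simp: hull_inc)
    have xh: "a h \<bullet> x = b h"
    proof -
      have "t * (a h \<bullet> y - a h \<bullet> z) = b h - a h \<bullet> z"
        using z(2)[OF h] yh by (simp add: t_def)
      then show ?thesis by (simp add: x_def inner_add_right algebra_simps)
    qed
    have xu: "a u \<bullet> x < b u" if u: "u \<in> V - {h}" for u
    proof -
      have "a u \<bullet> y \<le> b u" using y(2) u ab[of u] by blast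
      then have "t * (a u \<bullet> y) \<le> t * b u" using t by simp
      moreover have "(1 - t) * (a u \<bullet> z) < (1 - t) * b u" using z(2)[of u] u t by simp
      ultimately show ?thesis by (simp add: x_def inner_add_right algebra_simps)
    qed
    have "a u \<bullet> x \<le> b u" if "u \<in> V" for u
      using xh xu[of u] that by (cases "u = h") auto
    then have "x \<in> sols" using xL by (simp add: sols_def)
    then have "x \<in> Q" by (simp only: sols)
    moreover have "tgt x = {h}" using xh xu h by (force simp: tight_def)
    ultimately show ?thesis by blast
  qed
  then show ?thesis
    using that[of V a b] inequality_system_axioms sols ab by blast
qed

text \<open>The facet normals at an extreme point span the \<open>d\<close>-dimensional direction space, and there are
  exactly \<open>d\<close> of them.\<close>

lemma simple_polytope_exact_facets:
  fixes Q :: "'a::euclidean_space set"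
  assumes Q: "simple_polytope Q" and v: "v extreme_point_of Q"
    and M: "M \<subseteq> {F. F facet_of Q \<and> v \<in> F}"
  obtains y where "y \<in> Q" "{F. F facet_of Q \<and> y \<in> F} = M"
proof -
  have vQ: "v \<in> Q" using v by (simp add: extreme_point_of_def)
  have "polyhedron Q" using Q by (simp add: simple_polytope_def polytope_imp_polyhedron)
  with vQ obtain V :: "'a set set" and a b where sys: "inequality_system (affine hull Q) V a"
    and sols: "inequality_system.sols (affine hull Q) V a b = Q"
    and single: "\<And>v. v \<in> V \<Longrightarrow> a v \<noteq> 0 \<and> (\<exists>x\<in>Q. tight V a b x = {v})"
    using polyhedron_inequality_system[of Q thesis] by blast
  interpret inequality_system "affine hull Q" V a b by (rule sys)
  define \<phi> where "\<phi> = (\<lambda>h. {x \<in> Q. a h \<bullet> x = b h})"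
  have bij: "bij_betw \<phi> V {F. F facet_of Q}"
    using facets_sols single unfolding sols \<phi>_def by blast
  have tgt_facets: "bij_betw \<phi> (tgt x) {F. F facet_of Q \<and> x \<in> F}" if "x \<in> Q" for x
    using facets_through_point[of x] bij that unfolding sols \<phi>_def by simp
  have span: "span (a ` tgt v) = (\<lambda>y. y - v) ` (affine hull Q)"
    using extreme_point_span v unfolding sols by blast
  have "int (card (tgt v)) = aff_dim Q"
    using Q v bij_betw_same_card[OF tgt_facets[OF vQ]] by (simp add: simple_polytope_def)
  also have "aff_dim Q = int (dim ((\<lambda>y. y - v) ` (affine hull Q)))"
    using aff_dim_eq_dim_subtract[of v "affine hull Q"] vQ by (simp add: hull_inc)
  also have "\<dots> = int (dim (a ` tgt v))"
    unfolding span[symmetric] by simp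
  finally have card: "card (tgt v) = dim (a ` tgt v)" by simp
  have fin: "finite (tgt v)" using finV by (simp add: tight_def)
  have "dim (a ` tgt v) \<le> card (a ` tgt v)"
    using fin by (simp add: dim_le_card')
  then have card': "card (a ` tgt v) = card (tgt v)"
    using card card_image_le[OF fin, of a] by simp
  then have "inj_on a (tgt v)" using fin by (simp add: eq_card_imp_inj_on)
  moreover have "independent (a ` tgt v)"
    by (rule card_le_dim_spanning[OF order_refl span_superset]) (use fin card card' in auto)
  moreover have "the_inv_into V \<phi> ` M \<subseteq> tgt v"
  proof
    fix h assume "h \<in> the_inv_into V \<phi> ` M"
    then obtain F where F: "F \<in> M" "h = the_inv_into V \<phi> F" by blast
    then have "F \<in> \<phi> ` tgt v"
      using M tgt_facets[OF vQ] by (auto simp: bij_betw_def)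
    then obtain k where k: "k \<in> tgt v" "F = \<phi> k" by blast
    then have "k \<in> V" by (simp add: tight_def)
    then have "h = k" using F k bij by (simp add: bij_betw_def the_inv_into_f_f)
    then show "h \<in> tgt v" using k by simp
  qed
  ultimately obtain y where y: "y \<in> Q" "tgt y = the_inv_into V \<phi> ` M"
    using exact_tight_set[of v] vQ unfolding sols by metis
  have "\<phi> ` the_inv_into V \<phi> ` M = M"
  proof -
    have "\<phi> (the_inv_into V \<phi> F) = F" if "F \<in> M" for F
      using f_the_inv_into_f_bij_betw[OF bij] M that by blast
    then show ?thesis by (simp add: image_image)
  qed
  then have "{F. F facet_of Q \<and> y \<in> F} = M"
    using tgt_facets[OF y(1)] y(2) by (simp add: bij_betw_def)
  with y(1) that show ?thesis by blast
qed

text \<open>A vertex of the intersection lies on all facets in \<open>M\<close>, so some point of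
  \<open>Q\<close> lies on exactly these. It belongs to the intersection and rules out any further
  facet. The factor \<open>Q\<close> covers \<open>M = {}\<close>.\<close>

lemma simple_polytope_facet_Inter:
  fixes Q :: "'a::euclidean_space set"
  assumes Q: "simple_polytope Q" and M: "M \<subseteq> {F. F facet_of Q}" and ne: "Q \<inter> \<Inter>M \<noteq> {}"
  shows "(Q \<inter> \<Inter>M) face_of Q" and "{F. F facet_of Q \<and> Q \<inter> \<Inter>M \<subseteq> F} = M"
proof -
  have poly: "polytope Q" using Q by (simp add: simple_polytope_def)
  have "\<Inter>(insert Q M) face_of Q"
    by (rule face_of_Inter)
      (use M poly in \<open>auto simp: facet_of_imp_face_of face_of_refl_eq polytope_imp_convex\<close>)
  then show face: "(Q \<inter> \<Inter>M) face_of Q" by simp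
  have "polytope (Q \<inter> \<Inter>M)" using face poly by (rule face_of_polytope_polytope[rotated])
  then obtain v where "v extreme_point_of (Q \<inter> \<Inter>M)"
    using extreme_point_exists_convex[OF polytope_imp_compact polytope_imp_convex ne] by blast
  then have v: "v extreme_point_of Q" "v \<in> Q \<inter> \<Inter>M"
    using extreme_point_of_face[OF face] by auto
  then have "M \<subseteq> {F. F facet_of Q \<and> v \<in> F}" using M by blast
  then obtain y where "y \<in> Q" "{F. F facet_of Q \<and> y \<in> F} = M"
    using simple_polytope_exact_facets[OF Q v(1)] by blast
  then show "{F. F facet_of Q \<and> Q \<inter> \<Inter>M \<subseteq> F} = M" using M by blast
qed

text \<open>A nonempty face is recovered from the facets containing it, and by simplicity a set of
  facets with a common point is recovered from its intersection.\<close>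

lemma simple_polytope_faces:
  fixes Q :: "'a::euclidean_space set"
  assumes Q: "simple_polytope Q" "Q \<noteq> {}" and bij: "bij_betw \<phi> V {F. F facet_of Q}"
  shows "bij_betw (\<lambda>F. {v \<in> V. F \<subseteq> \<phi> v}) {F. F face_of Q \<and> F \<noteq> {}} {N. N \<subseteq> V \<and> \<Inter>(\<phi> ` N) \<noteq> {}}"
    and "F face_of Q \<Longrightarrow> F' face_of Q \<Longrightarrow> F \<noteq> {} \<Longrightarrow> F' \<noteq> {} \<Longrightarrow>
      F \<subseteq> F' \<longleftrightarrow> {v \<in> V. F' \<subseteq> \<phi> v} \<subseteq> {v \<in> V. F \<subseteq> \<phi> v}"
proof -
  have facets: "{F. F facet_of Q} = \<phi> ` V" using bij by (simp add: bij_betw_def)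
  have poly: "polyhedron Q" using Q by (simp add: simple_polytope_def polytope_imp_polyhedron)
  have face_eq: "F = Q \<inter> \<Inter>(\<phi> ` {v \<in> V. F \<subseteq> \<phi> v})" if F: "F face_of Q" "F \<noteq> {}" for F
  proof (cases "F = Q")
    case True
    then show ?thesis by auto
  next
    case False
    have "{G. G facet_of Q \<and> F \<subseteq> G} = \<phi> ` {v \<in> V. F \<subseteq> \<phi> v}"
      using facets by (auto simp: set_eq_iff)
    then show ?thesis
      using face_of_polyhedron[OF poly F(1,2) False] face_of_imp_subset[OF F(1)] by auto
  qed
  show "F \<subseteq> F' \<longleftrightarrow> {v \<in> V. F' \<subseteq> \<phi> v} \<subseteq> {v \<in> V. F \<subseteq> \<phi> v}"
    if "F face_of Q" "F' face_of Q" "F \<noteq> {}" "F' \<noteq> {}" for F F'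
  proof
    assume "{v \<in> V. F' \<subseteq> \<phi> v} \<subseteq> {v \<in> V. F \<subseteq> \<phi> v}"
    then have "Q \<inter> \<Inter>(\<phi> ` {v \<in> V. F \<subseteq> \<phi> v}) \<subseteq> Q \<inter> \<Inter>(\<phi> ` {v \<in> V. F' \<subseteq> \<phi> v})" by blast
    then show "F \<subseteq> F'" using face_eq that by simp
  qed blast
  show "bij_betw (\<lambda>F. {v \<in> V. F \<subseteq> \<phi> v}) {F. F face_of Q \<and> F \<noteq> {}} {N. N \<subseteq> V \<and> \<Inter>(\<phi> ` N) \<noteq> {}}"
  proof (rule bij_betwI[where g = "\<lambda>N. Q \<inter> \<Inter>(\<phi> ` N)"])
    show "(\<lambda>F. {v \<in> V. F \<subseteq> \<phi> v}) \<in> {F. F face_of Q \<and> F \<noteq> {}} \<rightarrow> {N. N \<subseteq> V \<and> \<Inter>(\<phi> ` N) \<noteq> {}}"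
      using face_eq by blast
    have N: "(Q \<inter> \<Inter>(\<phi> ` N)) face_of Q \<and> Q \<inter> \<Inter>(\<phi> ` N) \<noteq> {} \<and> {v \<in> V. Q \<inter> \<Inter>(\<phi> ` N) \<subseteq> \<phi> v} = N"
      if N: "N \<subseteq> V" "\<Inter>(\<phi> ` N) \<noteq> {}" for N
    proof -
      have sub: "\<phi> ` N \<subseteq> {F. F facet_of Q}" using N facets by blast
      have "\<phi> v \<subseteq> Q" if "v \<in> N" for v
        using sub that by (auto dest: facet_of_imp_subset)
      \<comment> \<open>For nonempty \<open>N\<close> the facets already lie in \<open>Q\<close>;
        for \<open>N = {}\<close> the intersection is \<open>Q\<close> itself.\<close>
      then have ne: "Q \<inter> \<Inter>(\<phi> ` N) \<noteq> {}"
        using N(2) Q(2) by (cases "N = {}") auto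
      have "v \<in> N" if "v \<in> V" "Q \<inter> \<Inter>(\<phi> ` N) \<subseteq> \<phi> v" for v
      proof -
        have "\<phi> v \<in> \<phi> ` N"
          using simple_polytope_facet_Inter(2)[OF Q(1) sub ne] that facets by blast
        then show ?thesis using bij N(1) that(1) by (auto simp: bij_betw_def inj_on_def)
      qed
      then show ?thesis
        using simple_polytope_facet_Inter(1)[OF Q(1) sub ne] ne N(1) by blast
    qed
    then show "(\<lambda>N. Q \<inter> \<Inter>(\<phi> ` N)) \<in> {N. N \<subseteq> V \<and> \<Inter>(\<phi> ` N) \<noteq> {}} \<rightarrow> {F. F face_of Q \<and> F \<noteq> {}}"
      by blast
    show "Q \<inter> \<Inter>(\<phi> ` {v \<in> V. F \<subseteq> \<phi> v}) = F" if "F \<in> {F. F face_of Q \<and> F \<noteq> {}}" for F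
      using face_eq[of F] that by simp
    show "{v \<in> V. Q \<inter> \<Inter>(\<phi> ` N) \<subseteq> \<phi> v} = N" if "N \<in> {N. N \<subseteq> V \<and> \<Inter>(\<phi> ` N) \<noteq> {}}" for N
      using N that by blast
  qed
qed

text \<open>The nonempty faces of \<open>P\<close> and of \<open>Q\<close> are in
  inclusion-reversing bijection with the same family of subsets of \<open>V\<close>; one bijection
  followed by the inverse of the other preserves inclusion.\<close>

lemma combinatorially_equivalent_if_same_facet_complex:
  fixes P :: "'a::euclidean_space set" and Q :: "'b::euclidean_space set"
  assumes P: "simple_polytope P" "P \<noteq> {}" and Q: "simple_polytope Q" "Q \<noteq> {}"
    and \<phi>: "bij_betw \<phi> V {F. F facet_of P}" and \<psi>: "bij_betw \<psi> V {F. F facet_of Q}"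
    and complex: "\<And>N. N \<subseteq> V \<Longrightarrow> \<Inter>(\<phi> ` N) \<noteq> {} \<longleftrightarrow> \<Inter>(\<psi> ` N) \<noteq> {}"
  shows "combinatorially_equivalent P Q"
proof -
  define \<alpha> where "\<alpha> F = {v \<in> V. F \<subseteq> \<phi> v}" for F
  define \<beta> where "\<beta> G = {v \<in> V. G \<subseteq> \<psi> v}" for G
  let ?A = "{F. F face_of P \<and> F \<noteq> {}}" and ?B = "{G. G face_of Q \<and> G \<noteq> {}}"
  have \<alpha>: "bij_betw \<alpha> ?A {N. N \<subseteq> V \<and> \<Inter>(\<phi> ` N) \<noteq> {}}"
    using simple_polytope_faces(1)[OF P \<phi>] by (simp add: \<alpha>_def[abs_def])
  have "bij_betw \<beta> ?B {N. N \<subseteq> V \<and> \<Inter>(\<psi> ` N) \<noteq> {}}"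
    using simple_polytope_faces(1)[OF Q \<psi>] by (simp add: \<beta>_def[abs_def])
  also have "{N. N \<subseteq> V \<and> \<Inter>(\<psi> ` N) \<noteq> {}} = {N. N \<subseteq> V \<and> \<Inter>(\<phi> ` N) \<noteq> {}}"
    using complex by blast
  finally have \<beta>: "bij_betw \<beta> ?B {N. N \<subseteq> V \<and> \<Inter>(\<phi> ` N) \<noteq> {}}" .
  define \<gamma> where "\<gamma> = the_inv_into ?B \<beta> \<circ> \<alpha>"
  have \<gamma>: "bij_betw \<gamma> ?A ?B"
    unfolding \<gamma>_def using \<alpha> bij_betw_the_inv_into[OF \<beta>] by (rule bij_betw_trans)
  have \<beta>\<gamma>: "\<beta> (\<gamma> F) = \<alpha> F" if "F \<in> ?A" for F
  proof -
    have "\<alpha> F \<in> {N. N \<subseteq> V \<and> \<Inter>(\<phi> ` N) \<noteq> {}}" using bij_betwE[OF \<alpha>] that by (rule bspec)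
    then show ?thesis
      unfolding \<gamma>_def comp_def by (rule f_the_inv_into_f_bij_betw[OF \<beta>])
  qed
  have mono: "F \<subseteq> F' \<longleftrightarrow> \<gamma> F \<subseteq> \<gamma> F'" if F: "F \<in> ?A" "F' \<in> ?A" for F F'
  proof -
    have "\<gamma> F \<in> ?B" "\<gamma> F' \<in> ?B" using bij_betwE[OF \<gamma>] F by (blast dest: bspec)+
    then have "\<gamma> F \<subseteq> \<gamma> F' \<longleftrightarrow> \<beta> (\<gamma> F') \<subseteq> \<beta> (\<gamma> F)"
      using simple_polytope_faces(2)[OF Q \<psi>, of "\<gamma> F" "\<gamma> F'"] unfolding \<beta>_def by blast
    moreover have "F \<subseteq> F' \<longleftrightarrow> \<alpha> F' \<subseteq> \<alpha> F"
      using simple_polytope_faces(2)[OF P \<phi>, of F F'] F unfolding \<alpha>_def by blast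
    ultimately show ?thesis using \<beta>\<gamma> F by simp
  qed
  \<comment> \<open>The empty face is outside the correspondence with index sets and is matched
    separately.\<close>
  define f where "f F = (if F = {} then {} else \<gamma> F)" for F
  have f: "f F = \<gamma> F" if "F \<in> ?A" for F using that by (simp add: f_def)
  have "bij_betw f ?A ?B" using \<gamma> bij_betw_cong[of ?A f \<gamma> ?B, OF f] by blast
  moreover have "bij_betw f {{}} {{}}" by (simp add: f_def)
  ultimately have "bij_betw f (?A \<union> {{}}) (?B \<union> {{}})"
    by (rule bij_betw_combine) simp
  moreover have "?A \<union> {{}} = {F. F face_of P}" "?B \<union> {{}} = {G. G face_of Q}" by auto
  moreover have "F \<subseteq> F' \<longleftrightarrow> f F \<subseteq> f F'" if F: "F face_of P" "F' face_of P" for F F'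
  proof -
    have "f F \<noteq> {}" if "F face_of P" "F \<noteq> {}" for F
      using bij_betwE[OF \<gamma>] f that by blast
    then show ?thesis
      using mono[of F F'] f F f_def by (cases "F = {}"; cases "F' = {}") auto
  qed
  ultimately show ?thesis unfolding combinatorially_equivalent_def by metis
qed

lemma extended_nestohedra_combinatorially_equivalent:
  assumes "is_extended_nestohedron B P" "is_extended_nestohedron B Q"
  shows "combinatorially_equivalent P Q"
proof -
  obtain \<phi> where \<phi>: "bij_betw \<phi> (B <+> UNIV) {F. F facet_of P}"
      "\<And>N. N \<subseteq> B <+> UNIV \<Longrightarrow> \<Inter>(\<phi> ` N) \<noteq> {} \<longleftrightarrow> N \<in> extended_nested_complex B"
    using assms(1) unfolding is_extended_nestohedron_def by blast
  obtain \<psi> where \<psi>: "bij_betw \<psi> (B <+> UNIV) {F. F facet_of Q}"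
      "\<And>N. N \<subseteq> B <+> UNIV \<Longrightarrow> \<Inter>(\<psi> ` N) \<noteq> {} \<longleftrightarrow> N \<in> extended_nested_complex B"
    using assms(2) unfolding is_extended_nestohedron_def by blast
  \<comment> \<open>The affine dimension of the empty set is -1, not
    \<open>CARD('n)\<close>.\<close>
  have "P \<noteq> {}" "Q \<noteq> {}" using assms by (auto simp: is_extended_nestohedron_def)
  moreover have "simple_polytope P" "simple_polytope Q"
    using assms by (simp_all add: is_extended_nestohedron_def)
  ultimately show ?thesis
    using combinatorially_equivalent_if_same_facet_complex[OF _ _ _ _ \<phi>(1) \<psi>(1)] \<phi>(2) \<psi>(2) by simp
qed

subsection \<open>The polymatroid of a building set\<close>

text \<open>Equal vectors at two different indices would satisfy a relation with coefficients 1 and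
  -1, so the indexed form of independence also yields injectivity.\<close>

lemma independent_image_if_scalars_zero:
  fixes f :: "'v \<Rightarrow> 'a::real_vector"
  assumes "finite N" and zero: "\<And>c. (\<Sum>v\<in>N. c v *\<^sub>R f v) = 0 \<Longrightarrow> \<forall>v\<in>N. c v = 0"
  shows "inj_on f N \<and> independent (f ` N)"
proof
  show inj: "inj_on f N"
  proof (rule inj_onI, rule ccontr)
    fix u v assume uv: "u \<in> N" "v \<in> N" "f u = f v" "u \<noteq> v"
    let ?c = "\<lambda>w. of_bool (w = u) - of_bool (w = v) :: real"
    have "(\<Sum>w\<in>N. ?c w *\<^sub>R f w) = (\<Sum>w\<in>N. if w = u then f u else 0) - (\<Sum>w\<in>N. if w = v then f v else 0)"
      unfolding sum_subtractf[symmetric] by (intro sum.cong) auto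
    also have "\<dots> = 0" using assms(1) uv by simp
    finally have "\<forall>w\<in>N. ?c w = 0" by (rule zero)
    with uv show False by auto
  qed
  show "independent (f ` N)"
  proof (rule independent_if_scalars_zero)
    fix g x assume g: "(\<Sum>x\<in>f ` N. g x *\<^sub>R x) = 0" and x: "x \<in> f ` N"
    have "(\<Sum>v\<in>N. (g \<circ> f) v *\<^sub>R f v) = 0"
      using g by (simp add: sum.reindex[OF inj])
    then show "g x = 0" using zero[of "g \<circ> f"] x by auto
  qed (use assms(1) in simp)
qed

section \<open>Indicator vectors and the facet inequalities\<close>

lemma inner_convex_hull_le:
  assumes "y \<in> convex hull S" "\<And>s. s \<in> S \<Longrightarrow> a \<bullet> s \<le> k"
  shows "a \<bullet> y \<le> k"
proof -
  have "convex hull S \<subseteq> {y. a \<bullet> y \<le> k}"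
    by (rule hull_minimal) (use assms(2) in \<open>auto simp: convex_halfspace_le\<close>)
  with assms(1) show ?thesis by blast
qed

lemma indicator_vec_nth: "indicator_vec S $ i = of_bool (i \<in> S)"
  by (simp add: indicator_vec_def axis_def sum.delta' if_distrib cong: if_cong)

lemma inner_indicator_vec: "indicator_vec S \<bullet> x = (\<Sum>i\<in>S. x $ i)"
  by (simp add: indicator_vec_def inner_sum_left inner_axis')

lemma inner_indicator_vecs: "indicator_vec S \<bullet> indicator_vec T = real (card (S \<inter> T))"
  by (simp add: inner_indicator_vec indicator_vec_nth sum.If_cases of_bool_def)

text \<open>The value of the support function of \<^term>\<open>minkowski_polytope B\<close> at \<^term>\<open>indicator_vec J\<close>:
  the summand of \<open>K\<close> contributes \<open>\<bar>J \<inter> K\<bar>\<close>, less one if \<open>K \<subseteq> J\<close> because \<open>S = K\<close> is excluded.\<close>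

definition nested_rank :: "'n::finite set set \<Rightarrow> 'n set \<Rightarrow> real" where
  "nested_rank B J = real (card J) + (\<Sum>K\<in>B. real (card (J \<inter> K)) - of_bool (K \<subseteq> J))"

text \<open>The minus sign turns \<open>0 \<le> x $ i\<close> into an upper bound.\<close>

fun facet_normal :: "'n::finite set + 'n \<Rightarrow> real ^ 'n" where
  "facet_normal (Inl I) = indicator_vec I"
| "facet_normal (Inr i) = - axis i 1"

fun facet_bound :: "'n::finite set set \<Rightarrow> 'n set + 'n \<Rightarrow> real" where
  "facet_bound B (Inl I) = nested_rank B I"
| "facet_bound B (Inr i) = 0"

locale building =
  fixes B :: "'n::finite set set"
  assumes building: "building_set B"
begin

sublocale inequality_system UNIV "B <+> UNIV" facet_normal "facet_bound B"
  by unfold_locales simp_all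

lemma empty_notin: "{} \<notin> B" and singleton_in: "{i} \<in> B"
  and Un_in: "I \<in> B \<Longrightarrow> J \<in> B \<Longrightarrow> I \<inter> J \<noteq> {} \<Longrightarrow> I \<union> J \<in> B"
  using building by (auto simp: building_set_def)

lemma sols_iff: "x \<in> sols \<longleftrightarrow> (\<forall>i. 0 \<le> x $ i) \<and> (\<forall>I\<in>B. (\<Sum>i\<in>I. x $ i) \<le> nested_rank B I)"
proof -
  have "(\<forall>v\<in>B <+> UNIV. Q v) \<longleftrightarrow> (\<forall>I\<in>B. Q (Inl I)) \<and> (\<forall>i. Q (Inr i))" for Q :: "'n set + 'n \<Rightarrow> bool"
    by auto
  then show ?thesis
    by (auto simp: sols_def inner_indicator_vec inner_axis')
qed

lemma tight_iff:
  "Inl I \<in> tgt x \<longleftrightarrow> I \<in> B \<and> (\<Sum>i\<in>I. x $ i) = nested_rank B I"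
  "Inr i \<in> tgt x \<longleftrightarrow> x $ i = 0"
  by (auto simp: tight_def inner_indicator_vec inner_axis')

section \<open>Submodularity and tight sets\<close>

lemma nested_rank_empty: "nested_rank B {} = 0"
  using empty_notin by (auto simp: nested_rank_def intro!: sum.neutral)

text \<open>The cardinality terms are modular, and the number of blocks inside a set, which enters
  negatively, is supermodular. For incomparable \<open>I\<close> and \<open>J\<close> whose union is
  a block, that block is counted for the union alone, whence strictness.\<close>

lemma nested_rank_submodular:
  "nested_rank B (I \<union> J) + nested_rank B (I \<inter> J) \<le> nested_rank B I + nested_rank B J" (is ?weak)
  and nested_rank_strict_submodular:
  "I \<union> J \<in> B \<Longrightarrow> \<not> I \<subseteq> J \<Longrightarrow> \<not> J \<subseteq> I \<Longrightarrow>
    nested_rank B (I \<union> J) + nested_rank B (I \<inter> J) < nested_rank B I + nested_rank B J"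
proof -
  have card_eq: "real (card ((I \<union> J) \<inter> K)) + real (card (I \<inter> J \<inter> K)) = real (card (I \<inter> K)) + real (card (J \<inter> K))" for K
  proof -
    have "(I \<union> J) \<inter> K = (I \<inter> K) \<union> (J \<inter> K)" "I \<inter> J \<inter> K = (I \<inter> K) \<inter> (J \<inter> K)" by auto
    then show ?thesis
      using card_Un_Int[of "I \<inter> K" "J \<inter> K"] by (simp flip: of_nat_add)
  qed
  let ?m = "\<lambda>K. of_bool (K \<subseteq> I \<union> J) + of_bool (K \<subseteq> I \<inter> J) :: real"
  let ?m' = "\<lambda>K. of_bool (K \<subseteq> I) + of_bool (K \<subseteq> J) :: real"
  have "(\<Sum>K\<in>B. real (card ((I \<union> J) \<inter> K))) + (\<Sum>K\<in>B. real (card (I \<inter> J \<inter> K))) =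
      (\<Sum>K\<in>B. real (card (I \<inter> K))) + (\<Sum>K\<in>B. real (card (J \<inter> K)))"
    unfolding sum.distrib[symmetric] by (intro sum.cong refl card_eq)
  then have eq: "nested_rank B (I \<union> J) + nested_rank B (I \<inter> J) + sum ?m B
      = nested_rank B I + nested_rank B J + sum ?m' B"
    using card_eq[of UNIV]
    by (simp add: nested_rank_def sum.distrib sum_subtractf)
  have le: "?m' K \<le> ?m K" for K by auto
  then have "sum ?m' B \<le> sum ?m B" by (intro sum_mono)
  with eq show ?weak by linarith
  assume "I \<union> J \<in> B" "\<not> I \<subseteq> J" "\<not> J \<subseteq> I"
  then have "sum ?m' B < sum ?m B"
    using le by (intro sum_strict_mono_ex1) (auto intro!: bexI[of _ "I \<union> J"])
  with eq show "nested_rank B (I \<union> J) + nested_rank B (I \<inter> J) < nested_rank B I + nested_rank B J"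
    by linarith
qed

text \<open>No block summand grows when \<open>i\<close> is removed, and the leading cardinality
  term, which stems from the segments \<open>Conv(0, e_i)\<close>, drops by 1.\<close>

lemma nested_rank_remove:
  assumes "i \<in> I"
  shows "nested_rank B (I - {i}) < nested_rank B I"
proof -
  have card_eq: "real (card ((I - {i}) \<inter> K)) = real (card (I \<inter> K)) - of_bool (i \<in> K)" for K
  proof (cases "i \<in> K")
    case True
    have "(I - {i}) \<inter> K = (I \<inter> K) - {i}" by blast
    moreover have "card (I \<inter> K) = Suc (card (I \<inter> K - {i}))"
      using True assms by (intro card.remove) auto
    ultimately show ?thesis using True by simp
  next
    case False
    then have "(I - {i}) \<inter> K = I \<inter> K" by blast
    with False show ?thesis by simp
  qed
  have "(\<Sum>K\<in>B. real (card ((I - {i}) \<inter> K)) - of_bool (K \<subseteq> I - {i}))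
      \<le> (\<Sum>K\<in>B. real (card (I \<inter> K)) - of_bool (K \<subseteq> I))"
    unfolding card_eq by (intro sum_mono) auto
  then show ?thesis
    using card_eq[of UNIV] by (simp add: nested_rank_def)
qed

text \<open>A maximal block \<open>I\<close> inside \<open>J\<close> contains every block inside
  \<open>J\<close> that it meets, by closure under unions. Hence the rank is additive over
  \<open>I\<close> and \<open>J - I\<close>, and induction applies to \<open>J - I\<close>.\<close>

lemma sum_le_nested_rank:
  assumes "x \<in> sols"
  shows "(\<Sum>i\<in>J. x $ i) \<le> nested_rank B J"
proof (induction "card J" arbitrary: J rule: less_induct)
  case less
  show ?case
  proof (cases "J = {}")
    case True
    then show ?thesis by (simp add: nested_rank_empty)
  next
    case False
    let ?C = "{I \<in> B. I \<subseteq> J}"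
    have "?C \<noteq> {}" using False singleton_in by blast
    then obtain I where I: "I \<in> ?C" "\<And>K. K \<in> ?C \<Longrightarrow> I \<subseteq> K \<Longrightarrow> I = K"
      using finite_has_maximal[of ?C] finite by meson
    have "I \<noteq> {}" using I(1) empty_notin by auto
    have split: "of_bool (K \<subseteq> J) = (of_bool (K \<subseteq> I) + of_bool (K \<subseteq> J - I) :: real)" if K: "K \<in> B" for K
    proof (cases "K \<subseteq> J \<and> K \<inter> I \<noteq> {}")
      case True
      then have "I \<union> K \<in> ?C" using Un_in[of I K] I(1) K by blast
      then have "K \<subseteq> I" using I(2)[of "I \<union> K"] by blast
      then show ?thesis using True by auto
    next
      case False
      have "K \<noteq> {}" using K empty_notin by auto
      then show ?thesis using False I(1) by auto
    qed
    have card_eq: "real (card (J \<inter> K)) = real (card (I \<inter> K)) + real (card ((J - I) \<inter> K))" for K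
    proof -
      have "J \<inter> K = (I \<inter> K) \<union> ((J - I) \<inter> K)" using I(1) by blast
      moreover have "(I \<inter> K) \<inter> ((J - I) \<inter> K) = {}" by blast
      ultimately show ?thesis by (metis card_Un_disjoint finite of_nat_add)
    qed
    have "nested_rank B J = nested_rank B I + nested_rank B (J - I)"
    proof -
      have "(\<Sum>K\<in>B. real (card (J \<inter> K)) - of_bool (K \<subseteq> J)) =
        (\<Sum>K\<in>B. (real (card (I \<inter> K)) - of_bool (K \<subseteq> I)) + (real (card ((J - I) \<inter> K)) - of_bool (K \<subseteq> J - I)))"
        by (intro sum.cong) (simp_all add: card_eq split)
      then show ?thesis using card_eq[of UNIV] by (simp add: nested_rank_def sum.distrib)
    qed
    moreover have "(\<Sum>i\<in>J - I. x $ i) \<le> nested_rank B (J - I)"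
      by (rule less) (use I(1) \<open>I \<noteq> {}\<close> in \<open>auto intro!: psubset_card_mono\<close>)
    moreover have "(\<Sum>i\<in>I. x $ i) \<le> nested_rank B I"
      using I(1) assms by (simp add: sols_iff)
    moreover have "(\<Sum>i\<in>J. x $ i) = (\<Sum>i\<in>I. x $ i) + (\<Sum>i\<in>J - I. x $ i)"
      using I(1) by (simp add: sum.subset_diff[of I J])
    ultimately show ?thesis by linarith
  qed
qed

text \<open>Union and intersection obey their bounds, so tightness of \<open>I\<close> and
  \<open>J\<close> forces equality in submodularity. This makes the union tight and contradicts the
  strict version for incomparable sets.\<close>

lemma tight_Un:
  assumes x: "x \<in> sols" and I: "(\<Sum>i\<in>I. x $ i) = nested_rank B I" and J: "(\<Sum>i\<in>J. x $ i) = nested_rank B J"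
  shows "(\<Sum>i\<in>I \<union> J. x $ i) = nested_rank B (I \<union> J)" and "I \<union> J \<in> B \<Longrightarrow> I \<subseteq> J \<or> J \<subseteq> I"
proof -
  have sum_eq: "(\<Sum>i\<in>I \<union> J. x $ i) + (\<Sum>i\<in>I \<inter> J. x $ i) = (\<Sum>i\<in>I. x $ i) + (\<Sum>i\<in>J. x $ i)"
    by (simp add: sum.union_inter)
  note le = sum_le_nested_rank[OF x, of "I \<union> J"] sum_le_nested_rank[OF x, of "I \<inter> J"]
  show "(\<Sum>i\<in>I \<union> J. x $ i) = nested_rank B (I \<union> J)"
    using sum_eq le I J nested_rank_submodular[of I J] by linarith
  show "I \<subseteq> J \<or> J \<subseteq> I" if "I \<union> J \<in> B"
    using sum_eq le I J nested_rank_strict_submodular[OF that] by argo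
qed

lemma tight_Union:
  assumes x: "x \<in> sols" and "finite M" and "\<And>I. I \<in> M \<Longrightarrow> (\<Sum>i\<in>I. x $ i) = nested_rank B I"
  shows "(\<Sum>i\<in>\<Union>M. x $ i) = nested_rank B (\<Union>M)"
  using assms(2,3)
proof (induction M)
  case empty
  then show ?case by (simp add: nested_rank_empty)
next
  case (insert I M)
  then show ?case using tight_Un(1)[OF x, of I "\<Union>M"] by simp
qed

text \<open>Tight blocks that meet have a block as union and so are comparable by
  \<open>tight_Un\<close>. The same lemma, applied to one block and the union of the others, keeps
  disjoint unions out of \<open>B\<close>.\<close>

lemma tight_nested:
  assumes x: "x \<in> sols"
  shows "tgt x \<in> extended_nested_complex B"
  unfolding extended_nested_complex_def mem_Collect_eq extended_nested_collection_def
proof (intro conjI allI impI)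
  show "tgt x \<subseteq> B <+> UNIV" by (auto simp: tight_def)
next
  fix I J assume "Inl I \<in> tgt x" "Inl J \<in> tgt x"
  then have IJ: "I \<in> B" "J \<in> B" "(\<Sum>i\<in>I. x $ i) = nested_rank B I" "(\<Sum>i\<in>J. x $ i) = nested_rank B J"
    by (simp_all add: tight_iff)
  then show "I \<subseteq> J \<or> J \<subseteq> I \<or> I \<inter> J = {}"
    using tight_Un(2)[OF x IJ(3,4)] Un_in[OF IJ(1,2)] by blast
next
  fix M assume M: "M \<subseteq> {I. Inl I \<in> tgt x}" "2 \<le> card M" "pairwise disjnt M"
  show "\<Union>M \<notin> B"
  proof
    assume U: "\<Union>M \<in> B"
    have MB: "I \<in> B \<and> (\<Sum>i\<in>I. x $ i) = nested_rank B I" if "I \<in> M" for I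
      using M(1) that tight_iff(1) by blast
    obtain I where I: "I \<in> M" using M(2) by fastforce
    have "M - {I} \<noteq> {}" using M(2) I by (metis Diff_eq_empty_iff card_mono card.empty card_insert_if
      finite.emptyI finite.insertI insert_absorb not_less_eq_eq numeral_2_eq_2 One_nat_def empty_iff)
    then obtain I' where I': "I' \<in> M" "I' \<noteq> I" by blast
    have disj: "I \<inter> J = {}" if "J \<in> M" "J \<noteq> I" for J
      using M(3) I that by (auto simp: pairwise_def disjnt_def)
    have "\<Union>M = I \<union> \<Union>(M - {I})" using I by blast
    moreover have "(\<Sum>i\<in>\<Union>(M - {I}). x $ i) = nested_rank B (\<Union>(M - {I}))"
      by (rule tight_Union[OF x]) (use MB in auto)
    ultimately have "I \<subseteq> \<Union>(M - {I}) \<or> \<Union>(M - {I}) \<subseteq> I"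
      using tight_Un(2)[OF x, of I "\<Union>(M - {I})"] MB[OF I] U by simp
    moreover have "I \<inter> \<Union>(M - {I}) = {}" using disj by blast
    moreover have "I \<noteq> {}" "I' \<noteq> {}" using MB I I' empty_notin by auto
    ultimately show False using I' by blast
  qed
next
  fix i I assume "Inr i \<in> tgt x" "Inl I \<in> tgt x"
  then have *: "x $ i = 0" "(\<Sum>j\<in>I. x $ j) = nested_rank B I" by (simp_all add: tight_iff)
  show "i \<notin> I"
  proof
    assume i: "i \<in> I"
    \<comment> \<open>Since \<open>x $ i = 0\<close>, the set \<open>I - {i}\<close> would attain
      the strictly larger bound of \<open>I\<close>.\<close>
    then have "(\<Sum>j\<in>I - {i}. x $ j) = nested_rank B I"
      using * by (simp add: sum.remove[of I i])
    then show False
      using sum_le_nested_rank[OF x, of "I - {i}"] nested_rank_remove[OF i] by linarith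
  qed
qed

text \<open>Otherwise the maximal members of \<open>N\<close> that meet but do not contain \<open>J\<close> would cover \<open>J\<close>, and their
  union would be a block.\<close>

lemma exists_pivot:
  assumes N: "N \<in> extended_nested_complex B" and J: "J \<in> B"
  shows "\<exists>j\<in>J. \<forall>K. Inl K \<in> N \<longrightarrow> j \<in> K \<longrightarrow> J \<subseteq> K"
proof (rule ccontr)
  assume no: "\<not> ?thesis"
  define C where "C = {K. Inl K \<in> N \<and> K \<inter> J \<noteq> {} \<and> \<not> J \<subseteq> K}"
  define M where "M = {K \<in> C. \<forall>K'\<in>C. K \<subseteq> K' \<longrightarrow> K = K'}"
  have ext: "extended_nested_collection B N"
    using N by (simp add: extended_nested_complex_def)
  have above: "\<exists>K'\<in>M. K \<subseteq> K'" if "K \<in> C" for K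
    using finite_has_maximal2[of C K] that by (force simp: M_def)
  have cover: "J \<subseteq> \<Union>M"
  proof
    fix j assume "j \<in> J"
    with no obtain K where "Inl K \<in> N" "j \<in> K" "\<not> J \<subseteq> K" by blast
    then have "K \<in> C" using \<open>j \<in> J\<close> by (auto simp: C_def)
    with above \<open>j \<in> K\<close> show "j \<in> \<Union>M" by blast
  qed
  have MN: "M \<subseteq> {K. Inl K \<in> N}" by (auto simp: M_def C_def)
  have lam: "K \<subseteq> K' \<or> K' \<subseteq> K \<or> K \<inter> K' = {}" if "K \<in> M" "K' \<in> M" for K K'
    using ext MN that unfolding extended_nested_collection_def by blast
  have "pairwise disjnt M"
  proof (rule pairwiseI)
    fix K K' assume K: "K \<in> M" "K' \<in> M" "K \<noteq> K'"
    then have "\<not> K \<subseteq> K'" "\<not> K' \<subseteq> K" by (auto simp: M_def)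
    with lam[OF K(1,2)] show "disjnt K K'" by (auto simp: disjnt_def)
  qed
  \<comment> \<open>A single member covering \<open>J\<close> would contain \<open>J\<close>, which
    the definition of \<open>C\<close> forbids.\<close>
  moreover have "2 \<le> card M"
  proof (rule ccontr)
    assume "\<not> 2 \<le> card M"
    then consider "M = {}" | K where "M = {K}"
      by (metis One_nat_def card_0_eq card_1_singletonE finite less_2_cases not_le)
    then show False
    proof cases
      case 1
      then show False using cover J empty_notin by auto
    next
      case 2
      then have "J \<subseteq> K" "K \<in> C" using cover by (auto simp: M_def)
      then show False by (simp add: C_def)
    qed
  qed
  ultimately have "\<Union>M \<notin> B"
    using ext MN unfolding extended_nested_collection_def by blast
  \<comment> \<open>Every member of \<open>M\<close> meets \<open>J\<close>, so the members can be
    joined to the block \<open>J\<close> one at a time.\<close>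
  moreover have "J \<union> \<Union>M' \<in> B" if "M' \<subseteq> M" for M'
    using finite[of M'] that
  proof (induction M')
    case empty
    then show ?case using J by simp
  next
    case (insert K M')
    then have K: "K \<in> C" by (auto simp: M_def)
    then have "Inl K \<in> B <+> UNIV"
      using ext unfolding C_def extended_nested_collection_def by blast
    then have "K \<in> B" by auto
    moreover have "K \<inter> (J \<union> \<Union>M') \<noteq> {}" using K by (auto simp: C_def)
    moreover have "J \<union> \<Union>M' \<in> B" using insert.IH insert.prems by simp
    ultimately have "K \<union> (J \<union> \<Union>M') \<in> B" using Un_in[of K "J \<union> \<Union>M'"] by blast
    then show ?case by (simp add: Un_ac)
  qed
  ultimately show False using cover by (metis order_refl Un_absorb1)
qed

section \<open>Boundedness and independence of the normals\<close>

lemma bounded_sols: "bounded sols"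
proof (rule bounded_subset)
  show "bounded (cbox 0 (\<chi> i. nested_rank B {i}))" by (rule bounded_cbox)
  show "sols \<subseteq> cbox 0 (\<chi> i. nested_rank B {i})"
  proof
    fix x assume x: "x \<in> sols"
    have "x $ i \<le> nested_rank B {i}" for i
      using sum_le_nested_rank[OF x, of "{i}"] by simp
    then show "x \<in> cbox 0 (\<chi> i. nested_rank B {i})"
      using x by (simp add: mem_box_cart sols_iff)
  qed
qed

text \<open>Coefficients of symbols vanish because their coordinates lie in no block of
  \<open>N\<close>. A maximal block \<open>J\<close> with nonzero coefficient is alone at the
  coordinate of its pivot: other blocks of \<open>N\<close> through the pivot contain
  \<open>J\<close> and so have coefficient 0.\<close>

lemma nested_independent:
  assumes N: "N \<in> extended_nested_complex B"
  shows "inj_on facet_normal N \<and> independent (facet_normal ` N)"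
proof (rule independent_image_if_scalars_zero)
  show "finite N" by simp
  fix c :: "'n set + 'n \<Rightarrow> real" assume c: "(\<Sum>v\<in>N. c v *\<^sub>R facet_normal v) = 0"
  let ?I = "{I. Inl I \<in> N}" and ?X = "{i. Inr i \<in> N}"
  have disj: "i \<notin> I" if "Inr i \<in> N" "Inl I \<in> N" for i I
    using N that by (auto simp: extended_nested_complex_def extended_nested_collection_def)
  have N_eq: "N = ?I <+> ?X"
  proof (rule set_eqI)
    show "v \<in> N \<longleftrightarrow> v \<in> ?I <+> ?X" for v by (cases v) auto
  qed
  have "(\<Sum>v\<in>?I <+> ?X. c v *\<^sub>R facet_normal v)
      = (\<Sum>I\<in>?I. c (Inl I) *\<^sub>R indicator_vec I) - (\<Sum>i\<in>?X. c (Inr i) *\<^sub>R axis i 1)"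
    by (simp add: sum.Plus sum_negf)
  with c have eq: "(\<Sum>I\<in>?I. c (Inl I) *\<^sub>R indicator_vec I) - (\<Sum>i\<in>?X. c (Inr i) *\<^sub>R axis i 1) = 0"
    unfolding N_eq[symmetric] by simp
  have coord: "(\<Sum>I\<in>?I. c (Inl I) * of_bool (i \<in> I)) = (if i \<in> ?X then c (Inr i) else 0)" for i
  proof -
    have "(\<Sum>j\<in>?X. c (Inr j) * axis j 1 $ i) = (\<Sum>j\<in>?X. if i = j then c (Inr j) else 0)"
      by (intro sum.cong) (auto simp: axis_def)
    also have "\<dots> = (if i \<in> ?X then c (Inr i) else 0)"
      by (simp add: sum.delta')
    finally show ?thesis
      using arg_cong[OF eq, of "\<lambda>x. x $ i"] by (simp add: sum_component indicator_vec_nth)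
  qed
  have cX: "c (Inr i) = 0" if "Inr i \<in> N" for i
  proof -
    have "(\<Sum>I\<in>?I. c (Inl I) * of_bool (i \<in> I)) = 0"
      using disj[OF that] by (intro sum.neutral) auto
    then show ?thesis using coord[of i] that by simp
  qed
  have cI: "c (Inl I) = 0" if I: "Inl I \<in> N" for I
  proof (rule ccontr)
    assume "c (Inl I) \<noteq> 0"
    then obtain J where J: "Inl J \<in> N" "c (Inl J) \<noteq> 0"
        and max: "\<And>K. Inl K \<in> N \<Longrightarrow> c (Inl K) \<noteq> 0 \<Longrightarrow> J \<subseteq> K \<Longrightarrow> J = K"
      using finite_has_maximal2[of "{J. Inl J \<in> N \<and> c (Inl J) \<noteq> 0}" I] I by auto
    have "J \<in> B" using N J(1)
      by (auto simp: extended_nested_complex_def extended_nested_collection_def)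
    then obtain j where j: "j \<in> J" "\<And>K. Inl K \<in> N \<Longrightarrow> j \<in> K \<Longrightarrow> J \<subseteq> K"
      using exists_pivot[OF N] by blast
    have "(\<Sum>I\<in>?I. c (Inl I) * of_bool (j \<in> I)) = (\<Sum>I\<in>?I. if I = J then c (Inl J) else 0)"
      using j max by (intro sum.cong) auto
    also have "\<dots> = c (Inl J)" using J(1) by simp
    finally have "(\<Sum>I\<in>?I. c (Inl I) * of_bool (j \<in> I)) = c (Inl J)" .
    \<comment> \<open>The pivot lies in \<open>J\<close>, so its symbol is not in \<open>N\<close>
      and \<open>coord\<close> gives 0.\<close>
    moreover have "(\<Sum>I\<in>?I. c (Inl I) * of_bool (j \<in> I)) = 0"
      using coord[of j] disj[OF _ J(1)] j(1) by (metis mem_Collect_eq)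
    ultimately show False using J(2) by simp
  qed
  show "\<forall>v\<in>N. c v = 0"
  proof
    fix v assume "v \<in> N"
    then show "c v = 0" using cX cI by (cases v) auto
  qed
qed

section \<open>The Minkowski sum as the solution set\<close>

lemma minkowski_subset_sols: "minkowski_polytope B \<subseteq> sols"
proof
  fix x assume "x \<in> minkowski_polytope B"
  then obtain s t where s: "\<And>i. s i \<in> convex hull {0, axis i 1}"
    and t: "\<And>J. J \<in> B \<Longrightarrow> t J \<in> convex hull {indicator_vec S | S. S \<subset> J}"
    and x: "x = (\<Sum>i\<in>UNIV. s i) + (\<Sum>J\<in>B. t J)"
    unfolding minkowski_polytope_def set_plus_def by (auto simp: set_sum_alt)
  \<comment> \<open>The inner product is additive, so each summand is bounded separately, at its
    generators.\<close>
  have "facet_normal v \<bullet> x \<le> facet_bound B v" for v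
  proof (cases v)
    case (Inl I)
    have "indicator_vec I \<bullet> s i \<le> of_bool (i \<in> I)" for i
      using s by (rule inner_convex_hull_le) (auto simp: inner_axis indicator_vec_nth)
    then have "(\<Sum>i\<in>UNIV. indicator_vec I \<bullet> s i) \<le> (\<Sum>i\<in>UNIV. of_bool (i \<in> I))"
      by (intro sum_mono)
    moreover have "indicator_vec I \<bullet> t J \<le> real (card (I \<inter> J)) - of_bool (J \<subseteq> I)" if "J \<in> B" for J
    proof (rule inner_convex_hull_le[OF t[OF that]])
      fix y assume "y \<in> {indicator_vec S :: real ^ 'n | S. S \<subset> J}"
      then obtain S where S: "S \<subset> J" "y = indicator_vec S" by blast
      \<comment> \<open>A proper subset of \<open>J\<close> misses an element of \<open>J\<close>,
        which costs at least 1 when \<open>J \<subseteq> I\<close>.\<close>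
      have "card (I \<inter> S) + of_bool (J \<subseteq> I) \<le> card (I \<inter> J)"
      proof (cases "J \<subseteq> I")
        case True
        then have "I \<inter> S \<subset> I \<inter> J" using S(1) by blast
        then show ?thesis using True psubset_card_mono[of "I \<inter> J" "I \<inter> S"] by simp
      next
        case False
        then show ?thesis using S(1) by (auto intro!: card_mono)
      qed
      then have "real (card (I \<inter> S) + of_bool (J \<subseteq> I)) \<le> real (card (I \<inter> J))"
        by (rule of_nat_mono)
      then show "indicator_vec I \<bullet> y \<le> real (card (I \<inter> J)) - of_bool (J \<subseteq> I)"
        by (simp add: S(2) inner_indicator_vecs)
    qed
    then have "(\<Sum>J\<in>B. indicator_vec I \<bullet> t J) \<le> (\<Sum>J\<in>B. real (card (I \<inter> J)) - of_bool (J \<subseteq> I))"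
      by (intro sum_mono)
    ultimately show ?thesis
      by (simp add: Inl x inner_add_right inner_sum_right nested_rank_def)
  next
    case (Inr i)
    have "- axis i 1 \<bullet> s j \<le> 0" for j
      using s by (rule inner_convex_hull_le) (auto simp: inner_axis_axis)
    moreover have "- axis i 1 \<bullet> t J \<le> 0" if "J \<in> B" for J
      using t[OF that] by (rule inner_convex_hull_le) (auto simp: inner_axis' indicator_vec_nth)
    ultimately have "(\<Sum>j\<in>UNIV. - axis i 1 \<bullet> s j) + (\<Sum>J\<in>B. - axis i 1 \<bullet> t J) \<le> 0"
      by (intro add_nonpos_nonpos sum_nonpos) auto
    then show ?thesis
      by (simp add: Inr x inner_add_right inner_sum_right)
  qed
  then show "x \<in> sols" by (simp add: sols_def)
qed

text \<open>In each summand one generator maximizes all normals of \<open>N\<close> at once.\<close>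

lemma exists_minkowski_point:
  assumes N: "N \<in> extended_nested_complex B"
  shows "\<exists>p\<in>minkowski_polytope B. N \<subseteq> tgt p"
proof -
  obtain j where j: "\<And>J. J \<in> B \<Longrightarrow> j J \<in> J" "\<And>J K. J \<in> B \<Longrightarrow> Inl K \<in> N \<Longrightarrow> j J \<in> K \<Longrightarrow> J \<subseteq> K"
    using exists_pivot[OF N] by metis
  define U where "U = \<Union>{K. Inl K \<in> N}"
  \<comment> \<open>Leaving out the pivot makes the subset of \<open>J\<close> proper; cutting with
    \<open>U\<close> makes the coordinates of the symbols in \<open>N\<close> vanish.\<close>
  define p :: "real ^ 'n" where "p = indicator_vec U + (\<Sum>J\<in>B. indicator_vec ((J - {j J}) \<inter> U))"
  have U: "indicator_vec U = (\<Sum>i\<in>UNIV. if i \<in> U then axis i (1::real) else 0)"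
    by (simp add: indicator_vec_def flip: sum.inter_filter[of UNIV "\<lambda>i. axis i 1" "\<lambda>i. i \<in> U"])
  have "(if i \<in> U then axis i 1 else 0) \<in> convex hull {0, axis i (1::real)}" for i
    by (rule hull_inc) simp
  then have "indicator_vec U \<in> (\<Sum>i\<in>UNIV. convex hull {0, axis i (1::real)})"
    unfolding U set_sum_alt[OF finite] by blast
  moreover have "(\<Sum>J\<in>B. indicator_vec ((J - {j J}) \<inter> U) :: real ^ 'n) \<in>
      (\<Sum>J\<in>B. convex hull {indicator_vec S | S. S \<subset> J})"
    using j(1) by (auto simp: set_sum_alt intro!: exI[of _ "\<lambda>J. indicator_vec ((J - {j J}) \<inter> U)"] hull_inc)
  ultimately have "p \<in> minkowski_polytope B"
    unfolding minkowski_polytope_def p_def by (rule set_plus_intro)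
  moreover have "v \<in> tgt p" if v: "v \<in> N" for v
  proof (cases v)
    case (Inl K)
    then have K: "Inl K \<in> N" "K \<subseteq> U" using v by (auto simp: U_def)
    \<comment> \<open>If \<open>K\<close> contains the pivot it contains \<open>J\<close>, and
      exactly the pivot is lost; otherwise \<open>J\<close> is not inside \<open>K\<close> and
      nothing is lost.\<close>
    have "real (card (K \<inter> ((J - {j J}) \<inter> U))) = real (card (K \<inter> J)) - of_bool (J \<subseteq> K)" if J: "J \<in> B" for J
    proof (cases "j J \<in> K")
      case True
      then have "J \<subseteq> K" using j(2) J K(1) by blast
      have "K \<inter> ((J - {j J}) \<inter> U) = K \<inter> J - {j J}" using K(2) by blast
      moreover have "card (K \<inter> J) = Suc (card (K \<inter> J - {j J}))"
        using True j(1)[OF J] by (intro card.remove) auto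
      ultimately show ?thesis using \<open>J \<subseteq> K\<close> by simp
    next
      case False
      then have "\<not> J \<subseteq> K" using j(1)[OF J] by blast
      moreover have "K \<inter> ((J - {j J}) \<inter> U) = K \<inter> J" using K(2) False by blast
      ultimately show ?thesis by simp
    qed
    then have "indicator_vec K \<bullet> p = nested_rank B K"
      using K(2) by (simp add: p_def inner_add_right inner_sum_right inner_indicator_vecs nested_rank_def Int_absorb2)
    moreover have "K \<in> B" using N K(1)
      by (auto simp: extended_nested_complex_def extended_nested_collection_def)
    ultimately show ?thesis by (simp add: Inl tight_iff inner_indicator_vec)
  next
    case (Inr i)
    then have "i \<notin> U" using N v
      by (auto simp: U_def extended_nested_complex_def extended_nested_collection_def)
    then show ?thesis
      by (simp add: Inr tight_iff p_def indicator_vec_nth sum_component)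
  qed
  ultimately show ?thesis by blast
qed

lemma nested_complex_subset:
  assumes N: "N \<in> extended_nested_complex B" and sub: "N' \<subseteq> N"
  shows "N' \<in> extended_nested_complex B"
proof -
  have "{I. Inl I \<in> N'} \<subseteq> {I. Inl I \<in> N}" using sub by blast
  then have "\<And>M. M \<subseteq> {I. Inl I \<in> N'} \<Longrightarrow> M \<subseteq> {I. Inl I \<in> N}" by (rule subset_trans[rotated])
  moreover have "\<And>v. v \<in> N' \<Longrightarrow> v \<in> N" using sub by blast
  ultimately show ?thesis
    using N unfolding extended_nested_complex_def extended_nested_collection_def mem_Collect_eq
    by (simp add: subset_iff)
qed

lemma nested_iff_tight:
  assumes "N \<subseteq> B <+> UNIV"
  shows "N \<in> extended_nested_complex B \<longleftrightarrow> (\<exists>x\<in>sols. N \<subseteq> tgt x)"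
  using exists_minkowski_point minkowski_subset_sols tight_nested nested_complex_subset by blast

text \<open>Only extreme points need to be placed in the convex Minkowski sum. The normals tight at
  an extreme point span the space, so a point of the sum at which they are all tight coincides with
  it.\<close>

lemma sols_eq_minkowski: "sols = minkowski_polytope B"
proof
  have "polytope sols" using polyhedron_sols bounded_sols by (simp add: polytope_eq_bounded_polyhedron)
  then have "sols = convex hull {x. x extreme_point_of sols}"
    by (intro Krein_Milman_Minkowski polytope_imp_compact polytope_imp_convex)
  also have "\<dots> \<subseteq> minkowski_polytope B"
  proof (rule hull_minimal)
    show "convex (minkowski_polytope B)"
      unfolding minkowski_polytope_def
      by (intro convex_set_plus convex_set_sum convex_convex_hull)
    show "{x. x extreme_point_of sols} \<subseteq> minkowski_polytope B"
    proof clarify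
      fix x assume x: "x extreme_point_of sols"
      then have "x \<in> sols" by (simp add: extreme_point_of_def)
      then obtain p where p: "p \<in> minkowski_polytope B" "tgt x \<subseteq> tgt p"
        using exists_minkowski_point[OF tight_nested] by blast
      have "orthogonal (x - p) y" if "y \<in> span (facet_normal ` tgt x)" for y
        using that
      proof (rule orthogonal_to_span)
        fix y assume "y \<in> facet_normal ` tgt x"
        then show "orthogonal (x - p) y"
          using p(2) by (auto simp: orthogonal_def tight_def inner_diff_right inner_commute[of "x - p"])
      qed
      moreover have "span (facet_normal ` tgt x) = UNIV"
        using extreme_point_span[OF x] by simp
      ultimately have "x - p = 0" using orthogonal_self by blast
      then show "x \<in> minkowski_polytope B" using p(1) by simp
    qed
  qed
  finally show "sols \<subseteq> minkowski_polytope B" .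
qed (rule minkowski_subset_sols)

lemma is_extended_nestohedron_minkowski: "is_extended_nestohedron B (minkowski_polytope B)"
proof -
  define \<phi> where "\<phi> = (\<lambda>v. {x \<in> sols. facet_normal v \<bullet> x = facet_bound B v})"
  have "{} \<in> extended_nested_complex B"
    by (auto simp: extended_nested_complex_def extended_nested_collection_def)
  then have ne: "sols \<noteq> {}" using nested_iff_tight[of "{}"] by auto
  have nondeg: "inj_on facet_normal (tgt x) \<and> independent (facet_normal ` tgt x)" if "x \<in> sols" for x
    using nested_independent[OF tight_nested[OF that]] .
  have att: "\<exists>x\<in>sols. v \<in> tgt x" if v: "v \<in> B <+> UNIV" for v
  proof -
    have "{v} \<in> extended_nested_complex B"
      unfolding extended_nested_complex_def mem_Collect_eq extended_nested_collection_def
    proof (intro conjI allI impI)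
      fix M assume M: "M \<subseteq> {I. Inl I \<in> {v}}" "2 \<le> card M"
      \<comment> \<open>At most one block occurs in \<open>{v}\<close>, so no family of two blocks
        arises.\<close>
      have "card M \<le> card (case v of Inl I \<Rightarrow> {I} | Inr i \<Rightarrow> {})"
        by (rule card_mono) (use M(1) in \<open>auto split: sum.splits\<close>)
      also have "\<dots> \<le> 1" by (auto split: sum.splits)
      finally show "\<Union>M \<notin> B" using M(2) by simp
    qed (use v in auto)
    then show ?thesis using nested_iff_tight[of "{v}"] v by simp
  qed
  \<comment> \<open>These discharge the assumptions of the nondegenerate context in order,
    \<open>refl\<close> standing for \<open>UNIV = UNIV\<close>.\<close>
  note system = refl bounded_sols ne nondeg att
  have "\<Inter>(\<phi> ` N) \<noteq> {} \<longleftrightarrow> N \<in> extended_nested_complex B" if N: "N \<subseteq> B <+> UNIV" for N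
  \<comment> \<open>The empty intersection is \<open>UNIV\<close> rather than \<open>sols\<close>,
    so it is treated apart.\<close>
  proof (cases "N = {}")
    case True
    then show ?thesis using \<open>{} \<in> extended_nested_complex B\<close> by simp
  next
    case False
    then have "x \<in> \<Inter>(\<phi> ` N) \<longleftrightarrow> x \<in> sols \<and> N \<subseteq> tgt x" for x
      using N by (auto simp: \<phi>_def tight_def)
    then show ?thesis unfolding nested_iff_tight[OF N] by blast
  qed
  then show ?thesis
    unfolding is_extended_nestohedron_def sols_eq_minkowski[symmetric]
    using simple_polytope_sols[OF system] full_dimensional[OF system] facets_nondegenerate[OF system]
    by (auto simp: \<phi>_def)
qed

end

theorem theorem3p6:
  fixes B :: "'n::finite set set"
  assumes "building_set B"
  shows "(\<exists>R :: (real ^ 'n) set. is_extended_nestohedron B R) \<and>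
         (\<forall>Q :: 'a::euclidean_space set.
            is_extended_nestohedron B Q \<longrightarrow> combinatorially_equivalent (minkowski_polytope B) Q)"
proof -
  interpret building B by unfold_locales (rule assms)
  \<comment> \<open>The Minkowski sum itself witnesses existence, and any two realizations, even in
    different spaces, are equivalent.\<close>
  show ?thesis
    using is_extended_nestohedron_minkowski extended_nestohedra_combinatorially_equivalent by blast
qed

end
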